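(* Let $T:\mathfrak h\to\mathfrak g$ be a nonabelian embedding tensor on a Lie algebra $\mathfrak g$ with respect to a coherent action $(\mathfrak h;\rho)$, and let $T':\mathfrak h\to\mathfrak g$ be a linear map. Then $T+T'$ is still a nonabelian embedding tensor on $\mathfrak g$ with respect to $(\mathfrak h;\rho)$ if and only if $T'$ is a Maurer-Cartan element of the differential graded Lie algebra $(C^*(\mathfrak h,\mathfrak g),\{\!\{-,-\}\!\},d_T)$, where $d_T=\mathrm d+\{\!\{T,-\}\!\}$.
   Context: All vector spaces are over a fixed field of characteristic zero. A coherent action of a Lie algebra $\mathfrak g$ on a Lie algebra $\mathfrak h$, denoted $(\mathfrak h;\rho)$, is a Lie algebra homomorphism $\rho:\mathfrak g\to\mathrm{Der}(\mathfrak h)$ such that $[\rho(x)u,v]_{\mathfrak h}=0$ for all $x\in\mathfrak g$, $u,v\in\mathfrak h$. A nonabelian embedding tensor on $\mathfrak g$ with respect to $(\mathfrak h;\rho)$ is a linear map $T:\mathfrak h\to\mathfrak g$ with $[Tu,Tv]_{\mathfrak g}=T\big(\rho(Tu)(v)+[u,v]_{\mathfrak h}\big)$ for all $u,v\in\mathfrak h$. $\mathbb S_{(i,j)}$ denotes the set of permutations $\sigma\in\mathbb S_{i+j}$ with $\sigma(1)<\cdots<\sigma(i)$ and $\sigma(i+1)<\cdots<\sigma(i+j)$ (only the identity if $i=0$ or $j=0$), and $(-1)^\sigma$ is the sign of $\sigma$. $C^*(\mathfrak h,\mathfrak g)=\bigoplus_{n=1}^{+\infty}\mathrm{Hom}(\otimes^n\mathfrak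 h,\mathfrak g)$, where $\mathrm{Hom}(\otimes^n\mathfrak h,\mathfrak g)$ has degree $n$. The map $\mathrm d:\mathrm{Hom}(\otimes^n\mathfrak h,\mathfrak g)\to\mathrm{Hom}(\otimes^{n+1}\mathfrak h,\mathfrak g)$ is $$(\mathrm d f)(v_1,\ldots,v_{n+1})=\sum_{1\le i<j\le n+1}(-1)^{n-1+i}f(v_1,\ldots,\hat v_i,\ldots,v_{j-1},[v_i,v_j]_{\mathfrak h},v_{j+1},\ldots,v_{n+1}).$$ The bracket $\{\!\{-,-\}\!\}:\mathrm{Hom}(\otimes^m\mathfrak h,\mathfrak g)\times\mathrm{Hom}(\otimes^n\mathfrak h,\mathfrak g)\to\mathrm{Hom}(\otimes^{m+n}\mathfrak h,\mathfrak g)$ is $$\begin{aligned}\{\!\{\theta,\phi\}\!\}(v_1,\ldots,v_{m+n})=&\sum_{k=1}^{m}\sum_{\sigma\in\mathbb S_{(k-1,n)}}(-1)^{(k-1)n+1}(-1)^\sigma\theta\big(v_{\sigma(1)},\ldots,v_{\sigma(k-1)},\rho(\phi(v_{\sigma(k)},\ldots,v_{\sigma(k+n-1)}))v_{k+n},v_{k+n+1},\ldots,v_{m+n}\big)\\&+\sum_{\sigma\in\mathbb S_{(m,n)}}(-1)^{mn+1}(-1)^\sigma[\theta(v_{\sigma(1)},\ldots,v_{\sigma(m)}),\phi(v_{\sigma(m+1)},\ldots,v_{\sigma(m+n)})]_{\mathfrak g}\\&+\sum_{k=1}^{n}\sum_{\sigma\in\mathbb S_{(k-1,m)}}(-1)^{m(k+n-1)}(-1)^\sigma\phi\big(v_{\sigma(1)},\ldots,v_{\sigma(k-1)},\rho(\theta(v_{\sigma(k)},\ldots,v_{\sigma(k+m-1)}))v_{k+m},v_{k+m+1},\ldots,v_{m+n}\big).\end{aligned}$$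 $(C^*(\mathfrak h,\mathfrak g),\{\!\{-,-\}\!\},\mathrm d)$ is a differential graded Lie algebra whose Maurer-Cartan elements are the nonabelian embedding tensors, so $d_T:=\mathrm d+\{\!\{T,-\}\!\}$ is a graded derivation with $d_T^2=0$ and $(C^*(\mathfrak h,\mathfrak g),\{\!\{-,-\}\!\},d_T)$ is a differential graded Lie algebra. A Maurer-Cartan element of a differential graded Lie algebra $(L,[-,-],d)$ is an element $\alpha$ of degree $1$ with $d\alpha+\frac12[\alpha,\alpha]=0$; here degree $1$ means $\alpha\in\mathrm{Hom}(\mathfrak h,\mathfrak g)$. *)

theory Defs
  imports
    Complex_Main
    "HOL-Library.Function_Algebras"
    "HOL-Combinatorics.Permutations"
begin

section \<open>Lie algebras, coherent actions, nonabelian embedding tensors\<close>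

text \<open>Vector spaces are whole types equipped with a scalar multiplication, as in the library locale
  \<^locale>\<open>vector_space\<close>.\<close>

locale lie_algebra = vector_space scale
  for scale :: "'k::field_char_0 \<Rightarrow> 'a::ab_group_add \<Rightarrow> 'a"
  and bracket :: "'a \<Rightarrow> 'a \<Rightarrow> 'a" +
  assumes bracket_linear_left: "Vector_Spaces.linear scale scale (\<lambda>x. bracket x y)"
    and bracket_linear_right: "Vector_Spaces.linear scale scale (bracket x)"
    and bracket_alternating: "bracket x x = 0"
    and jacobi: "bracket x (bracket y z) + bracket y (bracket z x) + bracket z (bracket x y) = 0"

definition lie_derivation ::
  "('k::field_char_0 \<Rightarrow> 'a::ab_group_add \<Rightarrow> 'a) \<Rightarrow> ('a \<Rightarrow> 'a \<Rightarrow> 'a) \<Rightarrow> ('a \<Rightarrow> 'a) \<Rightarrow> bool" where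
  "lie_derivation scale bracket D \<longleftrightarrow>
     Vector_Spaces.linear scale scale D \<and>
     (\<forall>u v. D (bracket u v) = bracket (D u) v + bracket u (D v))"

locale coherent_action =
  g: lie_algebra sg brg + h: lie_algebra sh brh
  for sg :: "'k::field_char_0 \<Rightarrow> 'g::ab_group_add \<Rightarrow> 'g"
  and brg :: "'g \<Rightarrow> 'g \<Rightarrow> 'g"
  and sh :: "'k \<Rightarrow> 'h::ab_group_add \<Rightarrow> 'h"
  and brh :: "'h \<Rightarrow> 'h \<Rightarrow> 'h" +
  fixes \<rho> :: "'g \<Rightarrow> 'h \<Rightarrow> 'h"
  assumes action_linear: "Vector_Spaces.linear sg sh (\<lambda>x. \<rho> x u)"
    and action_derivation: "lie_derivation sh brh (\<rho> x)"
    and action_bracket: "\<rho> (brg x y) u = \<rho> x (\<rho> y u) - \<rho> y (\<rho> x u)"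
    and coherent: "brh (\<rho> x u) v = 0"

definition nonabelian_embedding_tensor ::
  "('k::field_char_0 \<Rightarrow> 'g::ab_group_add \<Rightarrow> 'g) \<Rightarrow> ('g \<Rightarrow> 'g \<Rightarrow> 'g) \<Rightarrow>
   ('k \<Rightarrow> 'h::ab_group_add \<Rightarrow> 'h) \<Rightarrow> ('h \<Rightarrow> 'h \<Rightarrow> 'h) \<Rightarrow>
   ('g \<Rightarrow> 'h \<Rightarrow> 'h) \<Rightarrow> ('h \<Rightarrow> 'g) \<Rightarrow> bool" where
  "nonabelian_embedding_tensor sg brg sh brh \<rho> T \<longleftrightarrow>
     Vector_Spaces.linear sh sg T \<and>
     (\<forall>u v. brg (T u) (T v) = T (\<rho> (T u) v + brh u v))"


section \<open>Maurer-Cartan elements\<close>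

text \<open>A differential graded Lie algebra enters through its scalar multiplication, its homogeneous
  components \<open>L i\<close>, its bracket and its differential. The Maurer-Cartan condition uses only these
  data, so the graded Lie axioms are not carried as hypotheses.\<close>

definition maurer_cartan ::
  "('k::field_char_0 \<Rightarrow> 'a::ab_group_add \<Rightarrow> 'a) \<Rightarrow> (nat \<Rightarrow> 'a set) \<Rightarrow> ('a \<Rightarrow> 'a \<Rightarrow> 'a) \<Rightarrow>
   ('a \<Rightarrow> 'a) \<Rightarrow> 'a \<Rightarrow> bool" where
  "maurer_cartan scale L bracket diff \<alpha> \<longleftrightarrow>
     \<alpha> \<in> L 1 \<and> diff \<alpha> + scale (1/2) (bracket \<alpha> \<alpha>) = 0"


section \<open>The cochain complex\<close>

text \<open>\<open>Hom(\<otimes>\<^sup>n h, g)\<close> is the space of \<open>n\<close>-linear maps, an argument tuple \<open>(v\<^sub>1, ..., v\<^sub>n)\<close> being a list of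
  length \<open>n\<close>. A cochain is a function on lists of all lengths; the degree \<open>n\<close> component of the
  direct sum consists of those that vanish off the lists of length \<open>n\<close>, so the degree \<open>n\<close> part of a
  cochain is its restriction to lists of length \<open>n\<close>.\<close>

definition Hom_tensor ::
  "('k::field_char_0 \<Rightarrow> 'h::ab_group_add \<Rightarrow> 'h) \<Rightarrow> ('k \<Rightarrow> 'g::ab_group_add \<Rightarrow> 'g) \<Rightarrow>
   nat \<Rightarrow> ('h list \<Rightarrow> 'g) set" where
  "Hom_tensor sh sg n = {f.
     (\<forall>vs. length vs \<noteq> n \<longrightarrow> f vs = 0) \<and>
     (\<forall>vs i. length vs = n \<longrightarrow> i < n \<longrightarrow> Vector_Spaces.linear sh sg (\<lambda>x. f (vs[i := x])))}"

definition cochains ::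
  "('k::field_char_0 \<Rightarrow> 'h::ab_group_add \<Rightarrow> 'h) \<Rightarrow> ('k \<Rightarrow> 'g::ab_group_add \<Rightarrow> 'g) \<Rightarrow>
   nat \<Rightarrow> ('h list \<Rightarrow> 'g) set" where
  "cochains sh sg n = (if n \<ge> 1 then Hom_tensor sh sg n else {0})"

definition cochain_scale ::
  "('k \<Rightarrow> 'g \<Rightarrow> 'g) \<Rightarrow> 'k \<Rightarrow> ('h list \<Rightarrow> 'g) \<Rightarrow> 'h list \<Rightarrow> 'g" where
  "cochain_scale sg c f = (\<lambda>vs. sg c (f vs))"

text \<open>The identification of linear maps \<open>h \<rightarrow> g\<close> with cochains of degree 1.\<close>

definition cochain_of_map :: "('h \<Rightarrow> 'g::zero) \<Rightarrow> 'h list \<Rightarrow> 'g" where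
  "cochain_of_map T vs = (if length vs = 1 then T (hd vs) else 0)"

definition shuffle_perms :: "nat \<Rightarrow> nat \<Rightarrow> (nat \<Rightarrow> nat) set" where
  "shuffle_perms i j =
     {\<sigma>. \<sigma> permutes {1..i+j} \<and> strict_mono_on {1..i} \<sigma> \<and> strict_mono_on {i+1..i+j} \<sigma>}"

text \<open>The argument \<open>v\<^sub>i\<close> of a tuple, counted from 1.\<close>

abbreviation arg :: "'h list \<Rightarrow> nat \<Rightarrow> 'h" where
  "arg vs i \<equiv> vs ! (i - 1)"

text \<open>On a list of length \<open>n + 1\<close> the value below depends on the degree \<open>n\<close> component of \<open>f\<close> only, so
  the one definition covers all degrees.\<close>

definition cochain_d ::
  "('k::field_char_0 \<Rightarrow> 'g::ab_group_add \<Rightarrow> 'g) \<Rightarrow> ('h::ab_group_add \<Rightarrow> 'h \<Rightarrow> 'h) \<Rightarrow>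
   ('h list \<Rightarrow> 'g) \<Rightarrow> 'h list \<Rightarrow> 'g" where
  "cochain_d sg brh f vs =
     (let n = length vs - 1 in
      \<Sum>j\<in>{1..n+1}. \<Sum>i\<in>{1..<j}.
        sg ((-1) ^ (n - 1 + i))
          (f (map (arg vs) [1..<i] @ map (arg vs) [i+1..<j] @ [brh (arg vs i) (arg vs j)] @
              map (arg vs) [j+1..<n+2])))"

text \<open>The bracket of a degree \<open>m\<close> and a degree \<open>n\<close> cochain, at a tuple of length \<open>m + n\<close>.\<close>

definition bracket_hom ::
  "('k::field_char_0 \<Rightarrow> 'g::ab_group_add \<Rightarrow> 'g) \<Rightarrow> ('g \<Rightarrow> 'g \<Rightarrow> 'g) \<Rightarrow> ('g \<Rightarrow> 'h \<Rightarrow> 'h) \<Rightarrow>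
   nat \<Rightarrow> nat \<Rightarrow> ('h list \<Rightarrow> 'g) \<Rightarrow> ('h list \<Rightarrow> 'g) \<Rightarrow> 'h list \<Rightarrow> 'g" where
  "bracket_hom sg brg \<rho> m n \<theta> \<phi> vs =
     (\<Sum>k\<in>{1..m}. \<Sum>\<sigma>\<in>shuffle_perms (k - 1) n.
        sg ((-1) ^ ((k - 1) * n + 1) * of_int (sign \<sigma>))
          (\<theta> (map (\<lambda>i. arg vs (\<sigma> i)) [1..<k] @
              [\<rho> (\<phi> (map (\<lambda>i. arg vs (\<sigma> i)) [k..<k+n])) (arg vs (k + n))] @
              map (arg vs) [k+n+1..<m+n+1])))
   + (\<Sum>\<sigma>\<in>shuffle_perms m n.
        sg ((-1) ^ (m * n + 1) * of_int (sign \<sigma>))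
          (brg (\<theta> (map (\<lambda>i. arg vs (\<sigma> i)) [1..<m+1]))
               (\<phi> (map (\<lambda>i. arg vs (\<sigma> i)) [m+1..<m+n+1]))))
   + (\<Sum>k\<in>{1..n}. \<Sum>\<sigma>\<in>shuffle_perms (k - 1) m.
        sg ((-1) ^ (m * (k + n - 1)) * of_int (sign \<sigma>))
          (\<phi> (map (\<lambda>i. arg vs (\<sigma> i)) [1..<k] @
              [\<rho> (\<theta> (map (\<lambda>i. arg vs (\<sigma> i)) [k..<k+m])) (arg vs (k + m))] @
              map (arg vs) [k+m+1..<m+n+1])))"

text \<open>Its bilinear extension to the direct sum: the component of degree \<open>N\<close> is the sum of the
  contributions of all degrees \<open>m, n \<ge> 1\<close> with \<open>m + n = N\<close>.\<close>

definition cochain_bracket ::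
  "('k::field_char_0 \<Rightarrow> 'g::ab_group_add \<Rightarrow> 'g) \<Rightarrow> ('g \<Rightarrow> 'g \<Rightarrow> 'g) \<Rightarrow> ('g \<Rightarrow> 'h \<Rightarrow> 'h) \<Rightarrow>
   ('h list \<Rightarrow> 'g) \<Rightarrow> ('h list \<Rightarrow> 'g) \<Rightarrow> 'h list \<Rightarrow> 'g" where
  "cochain_bracket sg brg \<rho> \<theta> \<phi> vs =
     (\<Sum>m\<in>{1..<length vs}. bracket_hom sg brg \<rho> m (length vs - m) \<theta> \<phi> vs)"

lemma (in coherent_action) cochain_bracket_homogeneous:
  assumes "\<theta> \<in> Hom_tensor sh sg m" "\<phi> \<in> Hom_tensor sh sg n" "m \<ge> 1" "n \<ge> 1"
    and len: "length vs = m + n"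
  shows "cochain_bracket sg brg \<rho> \<theta> \<phi> vs = bracket_hom sg brg \<rho> m n \<theta> \<phi> vs"
proof -
  have \<theta>0: "\<theta> us = 0" if "length us \<noteq> m" for us
    using assms(1) that by (simp add: Hom_tensor_def)
  have \<phi>0: "\<phi> us = 0" if "length us \<noteq> n" for us
    using assms(2) that by (simp add: Hom_tensor_def)
  have brg0: "brg 0 y = 0" for y
  proof -
    interpret l: Vector_Spaces.linear sg sg "\<lambda>x. brg x y" by (rule g.bracket_linear_left)
    show ?thesis by (rule l.zero)
  qed
  have other: "bracket_hom sg brg \<rho> m' n' \<theta> \<phi> vs = 0" if "m' \<noteq> m" "n' \<noteq> n" for m' n'
    using that by (auto simp: bracket_hom_def \<theta>0 \<phi>0 brg0 intro!: sum.neutral)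
  have "bracket_hom sg brg \<rho> m' (length vs - m') \<theta> \<phi> vs =
      (if m' = m then bracket_hom sg brg \<rho> m n \<theta> \<phi> vs else 0)" if "m' \<in> {1..<length vs}" for m'
    using that len by (auto intro!: other)
  then show ?thesis
    using assms by (simp add: cochain_bracket_def)
qed

definition twisted_d ::
  "('k::field_char_0 \<Rightarrow> 'g::ab_group_add \<Rightarrow> 'g) \<Rightarrow> ('g \<Rightarrow> 'g \<Rightarrow> 'g) \<Rightarrow>
   ('h::ab_group_add \<Rightarrow> 'h \<Rightarrow> 'h) \<Rightarrow> ('g \<Rightarrow> 'h \<Rightarrow> 'h) \<Rightarrow> ('h \<Rightarrow> 'g) \<Rightarrow>
   ('h list \<Rightarrow> 'g) \<Rightarrow> 'h list \<Rightarrow> 'g" where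
  "twisted_d sg brg brh \<rho> T f =
     cochain_d sg brh f + cochain_bracket sg brg \<rho> (cochain_of_map T) f"

end

theory Submission
  imports Defs
begin

text \<open>For a linear map \<open>T\<close>, the defect \<open>[Tu, Tv] - T(\<rho>(Tu)v + [u, v])\<close> measures how far \<open>T\<close> is from
  being a nonabelian embedding tensor. Evaluated at a pair of vectors, the differential of \<open>T\<close> gives
  the part of the defect that is linear in \<open>T\<close>, and the bracket of cochains is the symmetric bilinear
  form that polarises twice the quadratic part. Hence the defect is
  \<open>dT + 1/2 {{T, T}}\<close>, and Taylor expansion of this quadratic function around \<open>T\<close> is exact:
  the defect of \<open>T + T'\<close> exceeds that of \<open>T\<close> by
  \<open>dT' + {{T, T'}} + 1/2 {{T', T'}} = d\<^sub>T T' + 1/2 {{T', T'}}\<close>.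
  When the defect of \<open>T\<close> is zero, that of \<open>T + T'\<close> vanishes precisely if this last cochain vanishes
  on all pairs (lemma \<open>embedding_defect_add\<close>).

  A cochain is a function on tuples of every length, so the Maurer-Cartan equation also has to hold
  off the pairs. There it is automatic, because the differential and the bracket respect the grading
  (lemmas \<open>cochain_d_off_degree\<close> and \<open>cochain_bracket_off_degree\<close>).\<close>

section \<open>Homogeneity of the differential and of the bracket\<close>

lemma Hom_tensor_off_degree:
  assumes "f \<in> Hom_tensor sh sg n" "length vs \<noteq> n"
  shows "f vs = 0"
  using assms by (simp add: Hom_tensor_def)

lemma Hom_tensor_zero_argument:
  assumes f: "f \<in> Hom_tensor sh sg n"
  shows "f (us @ [0] @ ws) = 0"
proof (cases "length (us @ [0] @ ws) = n")
  case True
  moreover from this have "length us < n"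
    by auto
  ultimately have "Vector_Spaces.linear sh sg (\<lambda>x. f ((us @ [0] @ ws)[length us := x]))"
    using f unfolding Hom_tensor_def by blast
  then interpret l: Vector_Spaces.linear sh sg "\<lambda>x. f ((us @ [0] @ ws)[length us := x])" .
  show ?thesis using l.zero by simp
next
  case False
  then show ?thesis by (rule Hom_tensor_off_degree[OF f])
qed

lemma cochain_of_map_in_Hom_tensor:
  assumes "Vector_Spaces.linear sh sg T"
  shows "cochain_of_map T \<in> Hom_tensor sh sg 1"
proof -
  have "(\<lambda>x. cochain_of_map T (vs[i := x])) = T" if "length vs = 1" "i < 1" for vs and i :: nat
    using that by (cases vs) (auto simp: cochain_of_map_def)
  then show ?thesis
    using assms by (auto simp: Hom_tensor_def cochain_of_map_def)
qed

context coherent_action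
begin

lemma bracket_zero_left: "brg 0 y = 0"
proof -
  interpret l: Vector_Spaces.linear sg sg "\<lambda>x. brg x y" by (rule g.bracket_linear_left)
  show ?thesis by (rule l.zero)
qed

lemma bracket_zero_right: "brg x 0 = 0"
proof -
  interpret l: Vector_Spaces.linear sg sg "brg x" by (rule g.bracket_linear_right)
  show ?thesis by (rule l.zero)
qed

lemma action_zero: "\<rho> 0 u = 0"
proof -
  interpret l: Vector_Spaces.linear sg sh "\<lambda>x. \<rho> x u" by (rule action_linear)
  show ?thesis by (rule l.zero)
qed

lemma bracket_add_left: "brg (x + y) z = brg x z + brg y z"
proof -
  interpret l: Vector_Spaces.linear sg sg "\<lambda>x. brg x z" by (rule g.bracket_linear_left)
  show ?thesis by (rule l.add)
qed

lemma bracket_add_right: "brg x (y + z) = brg x y + brg x z"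
proof -
  interpret l: Vector_Spaces.linear sg sg "brg x" by (rule g.bracket_linear_right)
  show ?thesis by (rule l.add)
qed

lemma action_add: "\<rho> (x + y) u = \<rho> x u + \<rho> y u"
proof -
  interpret l: Vector_Spaces.linear sg sh "\<lambda>x. \<rho> x u" by (rule action_linear)
  show ?thesis by (rule l.add)
qed

lemma bracket_antisym: "brg x y = - brg y x"
proof -
  have "brg (x + y) (x + y) = brg x y + brg y x"
    unfolding bracket_add_left bracket_add_right by (simp add: g.bracket_alternating)
  then have "brg x y + brg y x = 0"
    unfolding g.bracket_alternating by (rule sym)
  then show ?thesis
    by (simp add: eq_neg_iff_add_eq_0)
qed

text \<open>Inserting \<open>[v\<^sub>i, v\<^sub>j]\<close> in place of \<open>v\<^sub>j\<close> and deleting \<open>v\<^sub>i\<close> shortens a tuple by exactly one.\<close>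

lemma cochain_d_off_degree:
  assumes f: "f \<in> Hom_tensor sh sg n" and len: "length vs \<noteq> n + 1"
  shows "cochain_d sg brh f vs = 0"
  unfolding cochain_d_def Let_def
proof (intro sum.neutral ballI)
  fix j i
  assume "j \<in> {1..length vs - 1 + 1}" "i \<in> {1..<j}"
  then have "f (map (arg vs) [1..<i] @ map (arg vs) [i+1..<j] @ [brh (arg vs i) (arg vs j)] @
      map (arg vs) [j+1..<length vs - 1 + 2]) = 0"
    using len by (intro Hom_tensor_off_degree[OF f]) auto
  then show "sg ((-1) ^ (length vs - 1 - 1 + i))
      (f (map (arg vs) [1..<i] @ map (arg vs) [i+1..<j] @ [brh (arg vs i) (arg vs j)] @
        map (arg vs) [j+1..<length vs - 1 + 2])) = 0"
    by simp
qed

text \<open>In each summand the two cochains are evaluated on tuples of lengths \<open>p\<close> and \<open>q\<close>. If the outer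
  one has another degree the summand is zero outright; if the inner one has, the outer cochain or the
  Lie bracket receives a zero argument.\<close>

lemma bracket_hom_off_degree:
  assumes \<theta>: "\<theta> \<in> Hom_tensor sh sg m" and \<phi>: "\<phi> \<in> Hom_tensor sh sg n"
    and off: "p \<noteq> m \<or> q \<noteq> n"
  shows "bracket_hom sg brg \<rho> p q \<theta> \<phi> vs = 0"
proof -
  have outer_inner:
    "\<theta>' (us @ [\<rho> (\<phi>' ws) w] @ ws') = 0"
    if "\<theta>' \<in> Hom_tensor sh sg m'" "\<phi>' \<in> Hom_tensor sh sg n'"
      "length us + 1 + length ws' \<noteq> m' \<or> length ws \<noteq> n'"
    for \<theta>' \<phi>' m' n' us ws w ws'
  proof (cases "length ws = n'")
    case True
    then show ?thesis using that by (intro Hom_tensor_off_degree[OF that(1)]) auto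
  next
    case False
    then show ?thesis
      using Hom_tensor_off_degree[OF that(2)] Hom_tensor_zero_argument[OF that(1)]
      by (simp add: action_zero)
  qed
  have bracket: "brg (\<theta> us) (\<phi> ws) = 0" if "length us = p" "length ws = q" for us ws
    using off that Hom_tensor_off_degree[OF \<theta>] Hom_tensor_off_degree[OF \<phi>]
    by (metis bracket_zero_left bracket_zero_right)
  have "\<theta> (map (\<lambda>i. arg vs (\<sigma> i)) [1..<k] @
      [\<rho> (\<phi> (map (\<lambda>i. arg vs (\<sigma> i)) [k..<k+q])) (arg vs (k + q))] @
      map (arg vs) [k+q+1..<p+q+1]) = 0" if "k \<in> {1..p}" for k \<sigma>
    using that off by (intro outer_inner[OF \<theta> \<phi>]) auto
  moreover have "\<phi> (map (\<lambda>i. arg vs (\<sigma> i)) [1..<k] @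
      [\<rho> (\<theta> (map (\<lambda>i. arg vs (\<sigma> i)) [k..<k+p])) (arg vs (k + p))] @
      map (arg vs) [k+p+1..<p+q+1]) = 0" if "k \<in> {1..q}" for k \<sigma>
    using that off by (intro outer_inner[OF \<phi> \<theta>]) auto
  moreover have "brg (\<theta> (map (\<lambda>i. arg vs (\<sigma> i)) [1..<p+1]))
      (\<phi> (map (\<lambda>i. arg vs (\<sigma> i)) [p+1..<p+q+1])) = 0" for \<sigma>
    by (rule bracket) auto
  ultimately show ?thesis
    unfolding bracket_hom_def by simp
qed

lemma cochain_bracket_off_degree:
  assumes "\<theta> \<in> Hom_tensor sh sg m" "\<phi> \<in> Hom_tensor sh sg n" "length vs \<noteq> m + n"
  shows "cochain_bracket sg brg \<rho> \<theta> \<phi> vs = 0"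
  unfolding cochain_bracket_def
  using assms by (intro sum.neutral ballI bracket_hom_off_degree) auto

end

section \<open>The operations on linear maps\<close>

lemma shuffle_perms_0_1: "shuffle_perms 0 1 = {id}"
  by (auto simp: shuffle_perms_def permutes_sing monotone_on_def)

lemma shuffle_perms_1_1: "shuffle_perms 1 1 = {id, transpose 1 2}"
proof -
  have "{1..1 + 1} = {1, 2 :: nat}" "{1 + 1..1 + 1} = {2 :: nat}" by auto
  moreover have "\<sigma> permutes {1, 2} \<longleftrightarrow> \<sigma> = id \<or> \<sigma> = transpose 1 2" for \<sigma> :: "nat \<Rightarrow> nat"
    by (rule permutes_doubleton_iff)
  ultimately show ?thesis
    unfolding shuffle_perms_def by (auto simp: monotone_on_def)
qed

context coherent_action
begin

lemma cochain_d_of_map: "cochain_d sg brh (cochain_of_map T) [u, v] = - T (brh u v)"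
proof -
  have "{1..2} = {1, 2 :: nat}" "{1..<2} = {1 :: nat}" by auto
  then show ?thesis
    by (simp add: cochain_d_def cochain_of_map_def numeral_2_eq_2)
qed

lemma cochain_bracket_of_maps:
  "cochain_bracket sg brg \<rho> (cochain_of_map S) (cochain_of_map T) [u, v] =
     brg (S u) (T v) + brg (T u) (S v) - S (\<rho> (T u) v) - T (\<rho> (S u) v)"
proof -
  have "{1..<length [u, v]} = {1}" by auto
  moreover have "id \<noteq> transpose 1 (2 :: nat)"
    by (auto simp: fun_eq_iff transpose_def intro!: exI[of _ 1])
  moreover have "transpose (Suc 0) 2 (Suc (Suc 0)) = Suc 0"
    by (simp add: transpose_def)
  ultimately show ?thesis
    using shuffle_perms_0_1 shuffle_perms_1_1 bracket_antisym[of "S v" "T u"]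
    by (simp add: cochain_bracket_def bracket_hom_def cochain_of_map_def sign_swap_id)
qed

section \<open>The embedding tensor equation as a quadratic equation\<close>

definition embedding_defect :: "('h \<Rightarrow> 'g) \<Rightarrow> 'h \<Rightarrow> 'h \<Rightarrow> 'g" where
  "embedding_defect T u v = brg (T u) (T v) - T (\<rho> (T u) v + brh u v)"

text \<open>The square \<open>{{T', T'}}\<close> counts every quadratic term of the defect of \<open>T'\<close> twice, which the
  factor \<open>1/2\<close> undoes; the mixed terms of the defect of \<open>T + T'\<close> are exactly \<open>{{T, T'}}\<close>.\<close>

lemma embedding_defect_add:
  assumes T: "Vector_Spaces.linear sh sg T" and T': "Vector_Spaces.linear sh sg T'"
  shows "embedding_defect (\<lambda>w. T w + T' w) u v = embedding_defect T u v +
    (twisted_d sg brg brh \<rho> T (cochain_of_map T') +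
      cochain_scale sg (1/2)
        (cochain_bracket sg brg \<rho> (cochain_of_map T') (cochain_of_map T'))) [u, v]"
proof -
  interpret T: Vector_Spaces.linear sh sg T by (rule T)
  interpret T': Vector_Spaces.linear sh sg T' by (rule T')
  have half: "sg (1/2) (x + x) = x" for x
    by (simp add: g.scale_right_distrib flip: g.scale_left_distrib)
  have "cochain_bracket sg brg \<rho> (cochain_of_map T') (cochain_of_map T') [u, v] =
      (brg (T' u) (T' v) - T' (\<rho> (T' u) v)) + (brg (T' u) (T' v) - T' (\<rho> (T' u) v))"
    by (simp add: cochain_bracket_of_maps)
  then have "cochain_scale sg (1/2)
        (cochain_bracket sg brg \<rho> (cochain_of_map T') (cochain_of_map T')) [u, v] =
      brg (T' u) (T' v) - T' (\<rho> (T' u) v)"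
    by (simp only: cochain_scale_def half)
  then show ?thesis
    by (simp add: embedding_defect_def twisted_d_def cochain_d_of_map cochain_bracket_of_maps
        action_add bracket_add_left bracket_add_right T.add T'.add)
qed

lemma nonabelian_embedding_tensor_iff_defect:
  assumes "Vector_Spaces.linear sh sg T"
  shows "nonabelian_embedding_tensor sg brg sh brh \<rho> T \<longleftrightarrow> (\<forall>u v. embedding_defect T u v = 0)"
  using assms by (simp add: nonabelian_embedding_tensor_def embedding_defect_def)

lemma maurer_cartan_iff_on_pairs:
  assumes T: "Vector_Spaces.linear sh sg T" and T': "Vector_Spaces.linear sh sg T'"
  shows "maurer_cartan (cochain_scale sg) (cochains sh sg)
      (cochain_bracket sg brg \<rho>) (twisted_d sg brg brh \<rho> T) (cochain_of_map T') \<longleftrightarrow>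
    (\<forall>u v. (twisted_d sg brg brh \<rho> T (cochain_of_map T') +
      cochain_scale sg (1/2)
        (cochain_bracket sg brg \<rho> (cochain_of_map T') (cochain_of_map T'))) [u, v] = 0)"
    (is "?MC \<longleftrightarrow> (\<forall>u v. ?F [u, v] = 0)")
proof -
  note T_hom = cochain_of_map_in_Hom_tensor[OF T] and T'_hom = cochain_of_map_in_Hom_tensor[OF T']
  have off: "?F vs = 0" if "length vs \<noteq> 2" for vs
    using that cochain_d_off_degree[OF T'_hom, of vs]
      cochain_bracket_off_degree[OF T_hom T'_hom, of vs]
      cochain_bracket_off_degree[OF T'_hom T'_hom, of vs]
    by (simp add: twisted_d_def cochain_scale_def)
  have "?F vs = 0" if "\<forall>u v. ?F [u, v] = 0" for vs
  proof (cases "length vs = 2")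
    case True
    then obtain u v where "vs = [u, v]"
      by (auto simp: numeral_2_eq_2 length_Suc_conv)
    then show ?thesis using that by simp
  qed (rule off)
  then have "?F = 0 \<longleftrightarrow> (\<forall>u v. ?F [u, v] = 0)"
    unfolding fun_eq_iff[of ?F] zero_fun_apply by blast
  moreover have "cochain_of_map T' \<in> cochains sh sg 1"
    using T'_hom by (simp add: cochains_def)
  ultimately show ?thesis
    by (simp only: maurer_cartan_def simp_thms)
qed

end

theorem theorem4p3:
  fixes sg :: "'k::field_char_0 \<Rightarrow> 'g::ab_group_add \<Rightarrow> 'g"
    and brg :: "'g \<Rightarrow> 'g \<Rightarrow> 'g"
    and sh :: "'k \<Rightarrow> 'h::ab_group_add \<Rightarrow> 'h"
    and brh :: "'h \<Rightarrow> 'h \<Rightarrow> 'h"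
    and \<rho> :: "'g \<Rightarrow> 'h \<Rightarrow> 'h"
    and T T' :: "'h \<Rightarrow> 'g"
  assumes "coherent_action sg brg sh brh \<rho>"
    and "nonabelian_embedding_tensor sg brg sh brh \<rho> T"
    and "Vector_Spaces.linear sh sg T'"
  shows "nonabelian_embedding_tensor sg brg sh brh \<rho> (\<lambda>v. T v + T' v) \<longleftrightarrow>
         maurer_cartan (cochain_scale sg) (cochains sh sg)
           (cochain_bracket sg brg \<rho>) (twisted_d sg brg brh \<rho> T) (cochain_of_map T')"
proof -
  interpret coherent_action sg brg sh brh \<rho> by (rule assms(1))
  interpret hg: vector_space_pair sh sg ..
  have T: "Vector_Spaces.linear sh sg T"
    using assms(2) by (simp add: nonabelian_embedding_tensor_def)
  have T_defect: "embedding_defect T u v = 0" for u v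
    using assms(2) nonabelian_embedding_tensor_iff_defect[OF T] by blast
  have sum: "Vector_Spaces.linear sh sg (\<lambda>v. T v + T' v)"
    by (rule hg.linear_compose_add[OF T assms(3)])
  show ?thesis
    by (simp only: nonabelian_embedding_tensor_iff_defect[OF sum]
        maurer_cartan_iff_on_pairs[OF T assms(3)] embedding_defect_add[OF T assms(3)]
        T_defect add_0_left)
qed

end
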